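(* Let $H_n$ denote the number of distinct (as ordered trees) fringe subtrees of a uniformly random ordered binary tree with $n$ leaves, and let $c=2\sqrt{\ln 4/\pi}\approx 1.3285649405$. Then, as $n\to\infty$: (i) $\displaystyle \mathbb{E}(H_n)= c\frac{n}{\sqrt{\ln n}}(1+o(1))$; (ii) with high probability, $\displaystyle H_n = c\frac{n}{\sqrt{\ln n}}(1+o(1))$, i.e. for every fixed $\eta>0$, $\mathbb{P}\big(|H_n - c\, n/\sqrt{\ln n}| \le \eta\, n/\sqrt{\ln n}\big)\to 1$.
   Context: A binary tree is a rooted tree in which every node has either exactly two children or none; it is ordered if the children of each inner node are ordered. The size of a binary tree is its number of leaves. A uniformly random ordered binary tree with $n$ leaves is chosen uniformly among all $C_{n-1}=\frac1n\binom{2n-2}{n-1}$ ordered binary trees with $n$ leaves. A fringe subtree of a tree $t$ is the subtree consisting of a node $v$ of $t$ together with all its descendants; two fringe subtrees are distinct if they differ as ordered binary trees. "With high probability" means with probability tending to $1$ as $n\to\infty$. *)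

theory Defs
  imports "HOL-Probability.Probability" "HOL-Library.Tree" "HOL-Library.Landau_Symbols"
begin

text \<open>
  Ordered binary trees are unlabelled, so the node label type is \<^typ>\<open>unit\<close>:
  \<^const>\<open>Leaf\<close> is the one-node tree and \<^const>\<open>Node\<close> is an inner node with a left
  and a right child. The size in the sense used here (number of leaves) is
  \<^const>\<open>size1\<close>, not \<^const>\<open>size\<close>, which counts inner nodes.
\<close>

type_synonym binary_tree = "unit tree"

definition binary_trees :: "nat \<Rightarrow> binary_tree set" where
  "binary_trees n = {t. size1 t = n}"

lemma finite_binary_trees: "finite (binary_trees n)"
proof (induction n rule: less_induct)
  case (less n)
  have "binary_trees n \<subseteq>
    insert Leaf (\<Union>k<n. \<Union>m<n. (\<lambda>(l, r). Node l () r) ` (binary_trees k \<times> binary_trees m))"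
  proof
    fix t assume t: "t \<in> binary_trees n"
    show "t \<in> insert Leaf (\<Union>k<n. \<Union>m<n. (\<lambda>(l, r). Node l () r) ` (binary_trees k \<times> binary_trees m))"
    proof (cases t)
      case (Node l x r)
      have "size1 l < n" "size1 r < n"
        using t Node by (auto simp: binary_trees_def size1_size)
      then show ?thesis
        using Node by (force simp: binary_trees_def)
    qed simp
  qed
  then show ?case
    by (rule finite_subset) (use less in auto)
qed

lemma binary_trees_nonempty:
  assumes "n \<ge> 1"
  shows "binary_trees n \<noteq> {}"
  using assms
proof (induction n rule: nat_induct_at_least)
  case base
  have "Leaf \<in> binary_trees 1" by (simp add: binary_trees_def)
  then show ?case by blast
next
  case (Suc n)
  then obtain t where "t \<in> binary_trees n" by blast
  then have "Node Leaf () t \<in> binary_trees (Suc n)" by (simp add: binary_trees_def)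
  then show ?case by blast
qed

text \<open>The value at \<open>n = 0\<close>, where there is no tree to choose, is unspecified.\<close>

definition random_binary_tree :: "nat \<Rightarrow> binary_tree pmf" where
  "random_binary_tree n = pmf_of_set (binary_trees n)"

text \<open>
  \<^const>\<open>subtrees\<close> \<open>t\<close> is the set of the trees rooted at the nodes of \<open>t\<close>, leaves and
  \<open>t\<close> itself included, so its cardinality counts each fringe subtree once, however
  often it occurs.
\<close>

definition distinct_fringe_subtrees :: "binary_tree \<Rightarrow> nat" where
  "distinct_fringe_subtrees t = card (subtrees t)"

definition fringe_const :: real where
  "fringe_const = 2 * sqrt (ln 4 / pi)"

end

theory Submission
  imports Defs "HOL-Computational_Algebra.Formal_Power_Series" "HOL-Real_Asymp.Real_Asymp"
begin

text \<open>
  Write \<open>b\<^sub>k\<close> for the number of trees with \<open>k\<close> leaves and \<open>p\<^sub>j = (2j choose j) / 4\<^sup>j\<close>.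
  Generating functions count the trees with one or two disjoint marked copies of given
  fringe subtrees exactly. Since \<open>p\<^sub>j\<close> decreases and \<open>j p\<^sub>j\<close> increases, the expected
  number of copies of a tree \<open>s\<close> of size \<open>k\<close> is at least \<open>n 4\<^sup>1\<^sup>-\<^sup>k\<close>, and the expected number
  of disjoint pairs of copies of \<open>s\<close> and \<open>s'\<close>, of sizes \<open>k\<close> and \<open>l\<close>, is at most
  \<open>n\<^sup>2 4\<^sup>1\<^sup>-\<^sup>k 4\<^sup>1\<^sup>-\<^sup>l\<close>. Moreover the sum of \<open>b\<^sub>k 4\<^sup>1\<^sup>-\<^sup>k\<close> over \<open>i < k \<le> j\<close> telescopes to
  \<open>2 (p\<^sub>i - p\<^sub>j)\<close>.

  For an upper bound, count all trees of size at most \<open>I\<close> and all nodes whose fringe subtree is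
  larger: on average at most \<open>4\<^sup>I + 2 n p\<^sub>I\<close>. For a lower bound, take the number \<open>A\<close> of nodes
  whose fringe subtree has size in \<open>{J<..M}\<close> and subtract the number of pairs of coinciding
  ones, which is on average at most \<open>2 n\<^sup>2 / 4\<^sup>J\<close>. The mean of \<open>A\<close> is at least
  \<open>a = 2 n (p\<^sub>J - p\<^sub>M)\<close>, and the pair bound summed over all sizes in this range is exactly \<open>a\<^sup>2\<close>,
  so that only the few nested pairs contribute to the mean of \<open>(A - a)\<^sup>2\<close>, and \<open>A\<close> deviates
  from \<open>a\<close> by at most \<open>sqrt (8 M n)\<close> in \<open>L\<^sup>1\<close>. With \<open>4\<^sup>I\<close> about \<open>n / ln n\<close>, \<open>4\<^sup>J\<close> about \<open>n ln n\<close> and \<open>M\<close> about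
  \<open>sqrt n\<close>, Wallis' product turns both bounds into \<open>c n / sqrt (ln n)\<close>.
\<close>

section \<open>Generating functions of functions on trees, by number of leaves\<close>

definition tree_gf :: "(binary_tree \<Rightarrow> real) \<Rightarrow> real fps" where
  "tree_gf f = Abs_fps (\<lambda>n. \<Sum>t\<in>binary_trees n. f t)"

text \<open>Sums over pairs of children by their total size. When \<open>h\<close> factors into a
  function of \<open>l\<close> and one of \<open>r\<close>, this is a product of two
  \<open>tree_gf\<close>, which turns recursions on trees into algebraic equations.\<close>

definition node_gf :: "(binary_tree \<Rightarrow> binary_tree \<Rightarrow> real) \<Rightarrow> real fps" where
  "node_gf h = Abs_fps (\<lambda>n. \<Sum>i\<le>n. \<Sum>l\<in>binary_trees i. \<Sum>r\<in>binary_trees (n - i). h l r)"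

lemma binary_trees_0 [simp]: "binary_trees 0 = {}"
  by (auto simp: binary_trees_def size1_size)

lemma binary_trees_1 [simp]: "binary_trees (Suc 0) = {Leaf}"
proof -
  have "t = Leaf" if "size1 t = Suc 0" for t :: binary_tree
    using that by (cases t) (auto simp: size1_size)
  then show ?thesis by (auto simp: binary_trees_def)
qed

text \<open>Splitting at the root. The index runs over all of \<open>{..n}\<close> to match the
  Cauchy product of power series; \<open>i = 0\<close> and \<open>i = n\<close> contribute nothing
  because no tree has 0 leaves.\<close>

lemma binary_trees_decompose:
  "binary_trees n = (if n = 1 then {Leaf} else {}) \<union>
     (\<lambda>(i, l, r). Node l () r) ` (SIGMA i:{..n}. binary_trees i \<times> binary_trees (n - i))"
    (is "_ = ?L \<union> ?N")
proof (intro set_eqI iffI)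
  fix t assume t: "t \<in> binary_trees n"
  show "t \<in> ?L \<union> ?N"
  proof (cases t)
    case Leaf
    then show ?thesis using t by (auto simp: binary_trees_def)
  next
    case (Node l x r)
    then have "(size1 l, l, r) \<in> (SIGMA i:{..n}. binary_trees i \<times> binary_trees (n - i))"
      using t by (auto simp: binary_trees_def)
    then show ?thesis using Node by (intro UnI2) (force simp: image_iff)
  qed
next
  fix t assume "t \<in> ?L \<union> ?N"
  then show "t \<in> binary_trees n"
    by (auto simp: binary_trees_def split: if_splits)
qed

lemma sum_binary_trees:
  "(\<Sum>t\<in>binary_trees n. f t) = (if n = 1 then f Leaf else 0) +
     (\<Sum>i\<le>n. \<Sum>l\<in>binary_trees i. \<Sum>r\<in>binary_trees (n - i). (f (Node l () r) :: real))"
proof -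
  let ?S = "SIGMA i:{..n}. binary_trees i \<times> binary_trees (n - i)"
  have inj: "inj_on (\<lambda>(i, l, r). Node l () r) ?S"
    by (auto simp: inj_on_def binary_trees_def)
  have "(\<Sum>t\<in>binary_trees n. f t) =
      (\<Sum>t\<in>(if n = 1 then {Leaf} else {}). f t) + (\<Sum>t\<in>(\<lambda>(i, l, r). Node l () r) ` ?S. f t)"
    by (subst binary_trees_decompose, rule sum.union_disjoint) (auto simp: finite_binary_trees)
  also have "(\<Sum>t\<in>(\<lambda>(i, l, r). Node l () r) ` ?S. f t) = (\<Sum>(i, l, r)\<in>?S. f (Node l () r))"
    by (subst sum.reindex[OF inj]) (auto intro!: sum.cong)
  also have "\<dots> = (\<Sum>i\<le>n. \<Sum>l\<in>binary_trees i. \<Sum>r\<in>binary_trees (n - i). f (Node l () r))"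
    by (simp add: sum.cartesian_product sum.Sigma finite_binary_trees)
  finally show ?thesis by simp
qed

lemma tree_gf_decompose:
  "tree_gf f = fps_const (f Leaf) * fps_X + node_gf (\<lambda>l r. f (Node l () r))"
  by (rule fps_ext) (simp add: tree_gf_def node_gf_def sum_binary_trees[of f])

lemma node_gf_add: "node_gf (\<lambda>l r. f l r + g l r) = node_gf f + node_gf g"
  by (rule fps_ext) (simp add: node_gf_def sum.distrib)

lemma node_gf_times: "node_gf (\<lambda>l r. f l * g r) = tree_gf f * tree_gf g"
  by (rule fps_ext) (simp add: node_gf_def tree_gf_def fps_mult_nth sum_product atLeast0AtMost)

lemma node_gf_times_swap: "node_gf (\<lambda>l r. f r * g l) = tree_gf f * tree_gf g"
  using node_gf_times[of g f] by (simp add: mult.commute)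

lemma node_gf_left: "node_gf (\<lambda>l r. f l) = tree_gf f * tree_gf (\<lambda>_. 1)"
  using node_gf_times[of f "\<lambda>_. 1"] by simp

lemma node_gf_right: "node_gf (\<lambda>l r. f r) = tree_gf f * tree_gf (\<lambda>_. 1)"
  using node_gf_times[of "\<lambda>_. 1" f] by (simp add: mult.commute)

section \<open>The Catalan generating function and its derivatives\<close>

abbreviation num_trees :: "nat \<Rightarrow> real" where
  "num_trees n \<equiv> real (card (binary_trees n))"

abbreviation catalan_gf :: "real fps" where
  "catalan_gf \<equiv> tree_gf (\<lambda>_. 1)"

lemma catalan_gf_nth [simp]: "fps_nth catalan_gf n = num_trees n"
  by (simp add: tree_gf_def)

lemma catalan_gf_eq: "catalan_gf = fps_X + catalan_gf * catalan_gf"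
proof -
  have "catalan_gf = fps_const 1 * fps_X + node_gf (\<lambda>_ _. 1)"
    by (rule tree_gf_decompose)
  then show ?thesis
    by (simp add: node_gf_left)
qed

text \<open>The square root of 1 - 4X, the discriminant of the quadratic equation
  \<open>catalan_gf_eq\<close>. Writing it through \<open>catalan_gf\<close> avoids defining roots
  of power series.\<close>

definition disc :: "real fps" where
  "disc = 1 - 2 * catalan_gf"

lemma disc_square: "disc * disc = 1 - 4 * fps_X"
proof -
  have "disc * disc = 1 - 4 * (catalan_gf - catalan_gf * catalan_gf)"
    by (simp add: disc_def algebra_simps)
  also have "catalan_gf - catalan_gf * catalan_gf = fps_X"
    using catalan_gf_eq by (simp add: algebra_simps)
  finally show ?thesis .
qed

lemma disc_nonzero: "disc \<noteq> 0"
proof -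
  have "fps_nth disc 0 = 1" by (simp add: disc_def numeral_fps_const)
  then show ?thesis by auto
qed

lemma deriv_disc: "fps_deriv disc = - (2 * fps_deriv catalan_gf)"
  by (simp add: disc_def numeral_fps_const)

text \<open>Differentiate \<open>disc_square\<close>. Thus the derivative of
  \<open>catalan_gf\<close> is (1 - 4X)^(-1/2).\<close>

lemma disc_deriv_catalan: "disc * fps_deriv catalan_gf = 1"
proof -
  have "fps_deriv (disc * disc) = fps_deriv (1 - 4 * fps_X)"
    by (simp add: disc_square)
  also have "fps_deriv (1 - 4 * fps_X) = (- 4 :: real fps)"
    by (simp add: numeral_fps_const)
  finally have "4 * (disc * fps_deriv catalan_gf) = 4 * 1"
    by (simp add: deriv_disc algebra_simps)
  then show ?thesis by (subst (asm) mult_cancel_left) simp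
qed

text \<open>Differentiate \<open>disc_deriv_catalan\<close>. Thus the second derivative of
  \<open>catalan_gf\<close> is 2 (1 - 4X)^(-3/2), the form in which disjoint pairs are
  counted.\<close>

lemma disc_deriv2_catalan: "disc * disc * fps_deriv (fps_deriv catalan_gf) = 2 * fps_deriv catalan_gf"
proof -
  have "fps_deriv (disc * fps_deriv catalan_gf) = 0"
    by (simp add: disc_deriv_catalan)
  then have "disc * fps_deriv (fps_deriv catalan_gf) = 2 * fps_deriv catalan_gf * fps_deriv catalan_gf"
    by (simp add: deriv_disc)
  then have "disc * disc * fps_deriv (fps_deriv catalan_gf)
      = 2 * fps_deriv catalan_gf * (disc * fps_deriv catalan_gf)"
    by (simp add: mult_ac)
  then show ?thesis by (simp add: disc_deriv_catalan)
qed

text \<open>Multiply \<open>disc_deriv_catalan\<close> by \<open>disc\<close> and compare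
  coefficients of X^n; for \<open>n \<ge> 1\<close> the constant term 1 drops out.\<close>

lemma num_trees_rec:
  assumes "n \<ge> 1"
  shows "real (n + 1) * num_trees (n + 1) = (4 * real n - 2) * num_trees n"
proof -
  have "disc * disc * fps_deriv catalan_gf = disc"
    by (simp add: disc_deriv_catalan mult.assoc)
  then have "(1 - 4 * fps_X) * fps_deriv catalan_gf = 1 - 2 * catalan_gf"
    by (simp only: disc_square) (simp add: disc_def)
  then have eq: "fps_deriv catalan_gf - 4 * (fps_X * fps_deriv catalan_gf) = 1 - 2 * catalan_gf"
    by (simp add: algebra_simps)
  show ?thesis
    using arg_cong[OF eq, of "\<lambda>f. fps_nth f n"] assms
    by (simp add: numeral_fps_const algebra_simps)
qed

section \<open>Normalised central binomial coefficients\<close>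

text \<open>This is \<open>(2j choose j) / 4\<^sup>j\<close>.\<close>

definition central :: "nat \<Rightarrow> real" where
  "central j = real (j + 1) * num_trees (j + 1) / 4 ^ j"

lemma central_0 [simp]: "central 0 = 1"
  by (simp add: central_def)

lemma central_Suc: "central (Suc j) = (1 - 1 / (2 * real (Suc j))) * central j"
proof -
  have "real (Suc j + 1) * num_trees (Suc j + 1) = (4 * real (Suc j) - 2) * num_trees (Suc j)"
    by (rule num_trees_rec) simp
  then have "central (Suc j) = (4 * real (Suc j) - 2) * num_trees (Suc j) / 4 ^ Suc j"
    unfolding central_def by simp
  also have "4 * real (Suc j) - 2 = 4 * ((1 - 1 / (2 * real (Suc j))) * real (Suc j))"
    by (simp add: field_simps)
  finally show ?thesis by (simp only: central_def) simp
qed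

lemma central_pos: "central j > 0"
proof (induction j)
  case (Suc j)
  have "1 - 1 / (2 * real (Suc j)) > 0"
    by (simp add: field_simps)
  then show ?case unfolding central_Suc using Suc by (intro mult_pos_pos)
qed simp

lemma central_antimono: "i \<le> j \<Longrightarrow> central j \<le> central i"
proof (rule decseqD)
  show "decseq central"
  proof (rule decseq_SucI)
    fix j
    have "1 - 1 / (2 * real (Suc j)) \<le> 1"
      by simp
    then have "(1 - 1 / (2 * real (Suc j))) * central j \<le> 1 * central j"
      using central_pos[of j] by (intro mult_right_mono) auto
    then show "central (Suc j) \<le> central j"
      by (simp only: central_Suc mult_1_left)
  qed
qed

lemma central_le_1: "central j \<le> 1"
  using central_antimono[of 0 j] by simp

lemma index_central_mono: "i \<le> j \<Longrightarrow> real i * central i \<le> real j * central j"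
proof (rule incseqD)
  show "incseq (\<lambda>i. real i * central i)"
  proof (rule incseq_SucI)
    fix i
    have "real (Suc i) * central (Suc i) = (real i + 1 / 2) * central i"
      unfolding central_Suc by (simp add: field_simps)
    then show "real i * central i \<le> real (Suc i) * central (Suc i)"
      using central_pos[of i] by (simp add: distrib_right)
  qed
qed

lemma num_trees_eq: "n \<ge> 1 \<Longrightarrow> real n * num_trees n = 4 ^ (n - 1) * central (n - 1)"
  by (cases n) (simp_all add: central_def)

text \<open>By \<open>central_Suc\<close>, the difference \<open>central j - central (Suc j)\<close>
  is \<open>central j / (2 * real (Suc j))\<close>.\<close>

lemma num_trees_telescope: "num_trees (Suc j) / 4 ^ j = 2 * (central j - central (Suc j))"
proof -
  have "num_trees (Suc j) / 4 ^ j = central j / real (Suc j)"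
    by (simp add: central_def)
  then show ?thesis by (simp add: central_Suc field_simps)
qed

lemma num_trees_le: "num_trees (Suc j) \<le> 4 ^ j"
proof -
  have "num_trees (Suc j) \<le> real (j + 1) * num_trees (j + 1)"
    by (simp add: mult_le_cancel_right1)
  also have "\<dots> \<le> 4 ^ j"
    using central_le_1[of j] by (simp add: central_def)
  finally show ?thesis .
qed

lemma num_trees_pos: "n \<ge> 1 \<Longrightarrow> num_trees n > 0"
  using binary_trees_nonempty[of n] finite_binary_trees[of n] by (simp add: card_gt_0_iff)

section \<open>Exact counts of copies and of disjoint pairs of copies\<close>

primrec occ :: "binary_tree \<Rightarrow> binary_tree \<Rightarrow> real" where
  "occ s Leaf = of_bool (Leaf = s)"
| "occ s (Node l x r) = of_bool (Node l x r = s) + occ s l + occ s r"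

text \<open>Counts pairs of nodes, neither below the other, the first with fringe subtree
  \<open>s\<close> and the second with \<open>s'\<close>. Each pair is recorded at its lowest common
  ancestor. For \<open>s = s'\<close> every unordered pair counts twice.\<close>

primrec disjoint_pairs :: "binary_tree \<Rightarrow> binary_tree \<Rightarrow> binary_tree \<Rightarrow> real" where
  "disjoint_pairs s s' Leaf = 0"
| "disjoint_pairs s s' (Node l x r) = disjoint_pairs s s' l + disjoint_pairs s s' r
     + occ s l * occ s' r + occ s r * occ s' l"

lemma occ_nonneg: "occ s t \<ge> 0"
  by (induction t) auto

lemma disjoint_pairs_nonneg: "disjoint_pairs s s' t \<ge> 0"
  by (induction t) (auto simp: occ_nonneg)

lemma tree_gf_indicator: "tree_gf (\<lambda>t. of_bool (t = s)) = fps_X ^ size1 s"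
proof (rule fps_ext)
  fix n
  have "(\<Sum>t\<in>binary_trees n. of_bool (t = s)) = (of_bool (s \<in> binary_trees n) :: real)"
    by (simp add: of_bool_def finite_binary_trees)
  then show "fps_nth (tree_gf (\<lambda>t. of_bool (t = s))) n = fps_nth (fps_X ^ size1 s) n"
    unfolding tree_gf_def by (auto simp: binary_trees_def)
qed

text \<open>The recursive calls of \<open>occ\<close> on both children contribute
  \<open>2 * catalan_gf\<close> times the unknown series, which \<open>disc\<close> absorbs; only
  the indicator of \<open>s\<close> remains.\<close>

lemma tree_gf_occ: "disc * tree_gf (occ s) = fps_X ^ size1 s"
proof -
  define h where "h l r = (of_bool (Node l () r = s) :: real)" for l r
  have ind: "tree_gf (\<lambda>t. of_bool (t = s)) = fps_const (of_bool (Leaf = s)) * fps_X + node_gf h"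
    unfolding h_def by (rule tree_gf_decompose)
  have "tree_gf (occ s) = fps_const (of_bool (Leaf = s)) * fps_X
      + node_gf (\<lambda>l r. h l r + occ s l + occ s r)"
    by (subst tree_gf_decompose) (simp add: h_def)
  also have "\<dots> = tree_gf (\<lambda>t. of_bool (t = s)) + 2 * (tree_gf (occ s) * catalan_gf)"
    by (simp add: ind node_gf_add node_gf_left node_gf_right)
  finally show ?thesis
    by (simp add: tree_gf_indicator disc_def algebra_simps)
qed

lemma tree_gf_disjoint_pairs:
  "disc * tree_gf (disjoint_pairs s s') = 2 * (tree_gf (occ s) * tree_gf (occ s'))"
proof -
  have "tree_gf (disjoint_pairs s s')
      = node_gf (\<lambda>l r. disjoint_pairs s s' l + disjoint_pairs s s' r + occ s l * occ s' r + occ s r * occ s' l)"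
    by (subst tree_gf_decompose) simp
  also have "\<dots> = 2 * (tree_gf (disjoint_pairs s s') * catalan_gf) + 2 * (tree_gf (occ s) * tree_gf (occ s'))"
    by (simp add: node_gf_add node_gf_left node_gf_right node_gf_times node_gf_times_swap)
  finally show ?thesis
    by (simp add: disc_def algebra_simps)
qed

lemma sum_occ:
  assumes "size1 s \<le> n"
  shows "(\<Sum>t\<in>binary_trees n. occ s t) = real (n - size1 s + 1) * num_trees (n - size1 s + 1)"
proof -
  have "disc * tree_gf (occ s) = disc * (fps_X ^ size1 s * fps_deriv catalan_gf)"
    using disc_deriv_catalan by (simp add: tree_gf_occ mult_ac)
  then have "tree_gf (occ s) = fps_X ^ size1 s * fps_deriv catalan_gf"
    using disc_nonzero by simp
  then have "fps_nth (tree_gf (occ s)) n = fps_nth (fps_X ^ size1 s * fps_deriv catalan_gf) n"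
    by simp
  then show ?thesis using assms by (simp add: tree_gf_def fps_X_power_mult_nth)
qed

text \<open>Multiplied by \<open>disc\<close> three times, the series of the pairs becomes 2 X^k
  with k the total size, and the second derivative of \<open>catalan_gf\<close> becomes 2. So the
  series is X^k times that derivative.\<close>

lemma sum_disjoint_pairs:
  "(\<Sum>t\<in>binary_trees n. disjoint_pairs s s' t) =
    (if n < size1 s + size1 s' then 0
     else let m = n - (size1 s + size1 s') in
       real (m + 1) * (real (m + 2) * num_trees (m + 2)))"
proof -
  let ?k = "size1 s + size1 s'"
  have "disc * disc * (disc * tree_gf (disjoint_pairs s s'))
      = 2 * ((disc * tree_gf (occ s)) * (disc * tree_gf (occ s')))"
    by (simp add: tree_gf_disjoint_pairs mult_ac)
  also have "\<dots> = 2 * fps_X ^ ?k"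
    by (simp add: tree_gf_occ power_add)
  also have "\<dots> = fps_X ^ ?k * (2 * (disc * fps_deriv catalan_gf))"
    by (simp add: disc_deriv_catalan)
  also have "\<dots> = fps_X ^ ?k * (disc * (disc * disc * fps_deriv (fps_deriv catalan_gf)))"
    unfolding disc_deriv2_catalan by (simp add: mult_ac)
  finally have "(disc * disc * disc) * tree_gf (disjoint_pairs s s')
      = (disc * disc * disc) * (fps_X ^ ?k * fps_deriv (fps_deriv catalan_gf))"
    by (simp add: mult_ac)
  then have "tree_gf (disjoint_pairs s s') = fps_X ^ ?k * fps_deriv (fps_deriv catalan_gf)"
    using disc_nonzero by simp
  then have "fps_nth (tree_gf (disjoint_pairs s s')) n = fps_nth (fps_X ^ ?k * fps_deriv (fps_deriv catalan_gf)) n"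
    by simp
  then show ?thesis by (simp add: tree_gf_def fps_X_power_mult_nth Let_def algebra_simps)
qed

section \<open>Means over all trees of a given size\<close>

text \<open>The expectation as a finite sum, which is linear without integrability
  conditions.\<close>

definition mean :: "nat \<Rightarrow> (binary_tree \<Rightarrow> real) \<Rightarrow> real" where
  "mean n f = (\<Sum>t\<in>binary_trees n. f t) / num_trees n"

lemma expectation_random_binary_tree:
  assumes "n \<ge> 1"
  shows "measure_pmf.expectation (random_binary_tree n) f = mean n f"
  unfolding random_binary_tree_def mean_def
  using assms by (intro integral_pmf_of_set binary_trees_nonempty finite_binary_trees)

lemma mean_add: "mean n (\<lambda>t. f t + g t) = mean n f + mean n g"
  by (simp add: mean_def sum.distrib add_divide_distrib)

lemma mean_diff: "mean n (\<lambda>t. f t - g t) = mean n f - mean n g"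
  by (simp add: mean_def sum_subtractf diff_divide_distrib)

lemma mean_cmult: "mean n (\<lambda>t. c * f t) = c * mean n f"
  by (simp add: mean_def sum_distrib_left)

lemma mean_sum: "mean n (\<lambda>t. \<Sum>x\<in>A. f x t) = (\<Sum>x\<in>A. mean n (f x))"
  unfolding mean_def by (subst sum.swap) (simp add: sum_divide_distrib)

lemma mean_const: "n \<ge> 1 \<Longrightarrow> mean n (\<lambda>_. c) = c"
  using num_trees_pos[of n] by (simp add: mean_def)

lemma mean_mono: "(\<And>t. size1 t = n \<Longrightarrow> f t \<le> g t) \<Longrightarrow> mean n f \<le> mean n g"
  unfolding mean_def by (intro divide_right_mono sum_mono) (auto simp: binary_trees_def)

lemma mean_square_le: "(mean n f)\<^sup>2 \<le> mean n (\<lambda>t. (f t)\<^sup>2)"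
proof (cases "num_trees n = 0")
  case False
  have "(\<Sum>t\<in>binary_trees n. f t * 1)\<^sup>2 \<le> (\<Sum>t\<in>binary_trees n. (f t)\<^sup>2) * (\<Sum>t\<in>binary_trees n. 1\<^sup>2)"
    by (rule Cauchy_Schwarz_ineq_sum)
  then have "(\<Sum>t\<in>binary_trees n. f t)\<^sup>2 \<le> (\<Sum>t\<in>binary_trees n. (f t)\<^sup>2) * num_trees n"
    by simp
  then show ?thesis
    using False by (simp add: mean_def power_divide divide_simps power2_eq_square)
qed (simp add: mean_def)

text \<open>\<open>real n * weight s\<close> is the leading term, for fixed \<open>s\<close>, of the
  mean number of copies of \<open>s\<close> in a tree of size \<open>n\<close>.\<close>

definition weight :: "binary_tree \<Rightarrow> real" where
  "weight s = 1 / 4 ^ (size1 s - 1)"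

lemma size1_ge_1: "1 \<le> size1 t"
  by (simp add: size1_size)

lemma weight_nonneg: "weight s \<ge> 0"
  by (simp add: weight_def)

text \<open>The mean equals \<open>real n * weight s\<close> times
  \<open>central (n - size1 s) / central (n - 1)\<close>, and this ratio is at least 1 because
  \<open>central\<close> decreases.\<close>

lemma mean_occ_ge:
  assumes "size1 s \<le> n"
  shows "real n * weight s \<le> mean n (occ s)"
proof -
  let ?k = "size1 s - 1" and ?m = "n - size1 s"
  have k: "size1 s \<ge> 1" by (rule size1_ge_1)
  have occ: "(\<Sum>t\<in>binary_trees n. occ s t) = 4 ^ ?m * central ?m"
    using num_trees_eq[of "?m + 1"] assms by (simp add: sum_occ)
  have "real n * num_trees n = 4 ^ (n - 1) * central (n - 1)"
    using assms k by (intro num_trees_eq) simp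
  also have "\<dots> \<le> 4 ^ (n - 1) * central ?m"
    using k by (intro mult_left_mono central_antimono) auto
  also have "n - 1 = ?k + ?m" using assms k by simp
  also have "4 ^ (?k + ?m) * central ?m = 4 ^ ?k * (\<Sum>t\<in>binary_trees n. occ s t)"
    by (simp only: occ power_add mult_ac)
  finally show ?thesis
    using num_trees_pos[of n] assms k by (simp add: mean_def weight_def field_simps)
qed

text \<open>Unless it vanishes, the mean is \<open>real n * weight s * weight s'\<close> times
  \<open>real (m + 1) * central (m + 1) / central (n - 1)\<close>. As
  \<open>m + 1 \<le> n - 1\<close>, \<open>index_central_mono\<close> bounds the last quotient by
  \<open>real (n - 1)\<close>.\<close>

lemma mean_disjoint_pairs_le:
  assumes "n \<ge> 1"
  shows "mean n (disjoint_pairs s s') \<le> (real n)\<^sup>2 * weight s * weight s'"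
proof (cases "n < size1 s + size1 s'")
  case True
  then show ?thesis by (simp add: mean_def sum_disjoint_pairs weight_nonneg)
next
  case False
  define m where "m = n - (size1 s + size1 s')"
  let ?k = "size1 s - 1" and ?l = "size1 s' - 1"
  let ?S = "\<Sum>t\<in>binary_trees n. disjoint_pairs s s' t"
  have k: "size1 s \<ge> 1" "size1 s' \<ge> 1" by (rule size1_ge_1)+
  have n: "n - 1 = ?k + ?l + (m + 1)" using False k by (simp add: m_def)
  have "?S = real (m + 1) * (real (m + 2) * num_trees (m + 2))"
    using False by (simp add: sum_disjoint_pairs m_def Let_def)
  also have "\<dots> = 4 ^ (m + 1) * (real (m + 1) * central (m + 1))"
    using num_trees_eq[of "m + 2"] by simp
  also have "\<dots> \<le> 4 ^ (m + 1) * (real (n - 1) * central (n - 1))"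
    using n by (intro mult_left_mono index_central_mono) auto
  also have "\<dots> \<le> 4 ^ (m + 1) * (real n * central (n - 1))"
    using central_pos[of "n - 1"] by (intro mult_left_mono mult_right_mono) auto
  finally have "4 ^ (?k + ?l) * ?S \<le> 4 ^ (?k + ?l) * (4 ^ (m + 1) * (real n * central (n - 1)))"
    by (intro mult_left_mono) auto
  also have "\<dots> = real n * (4 ^ (n - 1) * central (n - 1))"
    by (subst (2) n) (simp add: power_add)
  also have "\<dots> = (real n)\<^sup>2 * num_trees n"
    using num_trees_eq[of n] assms by (simp add: power2_eq_square)
  finally show ?thesis
    using num_trees_pos[OF assms] by (simp add: mean_def weight_def field_simps power_add)
qed

section \<open>Counting nodes whose fringe subtree lies in a finite set\<close>

text \<open>Counts nodes, so repeated fringe subtrees count repeatedly. This reading needs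
  \<open>Q\<close> finite, since a sum over an infinite set is 0.\<close>

definition count_in :: "binary_tree set \<Rightarrow> binary_tree \<Rightarrow> real" where
  "count_in Q t = (\<Sum>s\<in>Q. occ s t)"

lemma count_in_Leaf: "finite Q \<Longrightarrow> count_in Q Leaf = of_bool (Leaf \<in> Q)"
  by (simp add: count_in_def of_bool_def sum.delta)

lemma count_in_Node:
  "finite Q \<Longrightarrow> count_in Q (Node l x r) = of_bool (Node l x r \<in> Q) + count_in Q l + count_in Q r"
  by (simp add: count_in_def sum.distrib of_bool_def sum.delta)

lemma finite_subtrees: "finite (subtrees t)"
  by (induction t) auto

lemma size1_subtrees: "s \<in> subtrees t \<Longrightarrow> size1 s \<le> size1 t"
  by (induction t) auto

text \<open>\<open>2 * size1 t - 1\<close> is the number of all nodes, and the distinct fringe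
  subtrees outside \<open>Q\<close> are at most as many as the nodes carrying them. It also bounds
  \<open>count_in Q t\<close> by the number of nodes.\<close>

lemma card_subtrees_diff_le:
  assumes "finite Q"
  shows "real (card (subtrees t - Q)) + count_in Q t \<le> 2 * real (size1 t) - 1"
proof (induction t)
  case Leaf
  then show ?case using assms by (cases "Leaf \<in> Q") (auto simp: count_in_Leaf insert_Diff_if)
next
  case (Node l x r)
  let ?t = "Node l x r"
  have "card (subtrees ?t - Q) \<le> card (({?t} - Q) \<union> ((subtrees l - Q) \<union> (subtrees r - Q)))"
    by (intro card_mono) (auto simp: finite_subtrees)
  also have "\<dots> \<le> card ({?t} - Q) + (card (subtrees l - Q) + card (subtrees r - Q))"
    by (intro order_trans[OF card_Un_le] add_mono card_Un_le order_refl)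
  finally have "real (card (subtrees ?t - Q))
      \<le> real (card ({?t} - Q)) + real (card (subtrees l - Q)) + real (card (subtrees r - Q))"
    by simp
  moreover have "real (card ({?t} - Q)) + of_bool (?t \<in> Q) = 1"
    by (cases "?t \<in> Q") (auto simp: insert_Diff_if)
  ultimately show ?case using Node assms by (simp add: count_in_Node)
qed

lemma distinct_fringe_subtrees_le:
  assumes "finite Q"
  shows "real (distinct_fringe_subtrees t) \<le> real (card Q) + (2 * real (size1 t) - count_in Q t)"
proof -
  have "card (subtrees t) \<le> card (Q \<union> (subtrees t - Q))"
    using assms by (intro card_mono) (auto simp: finite_subtrees)
  also have "\<dots> \<le> card Q + card (subtrees t - Q)"
    by (rule card_Un_le)
  finally have "real (card (subtrees t)) \<le> real (card Q) + real (card (subtrees t - Q))"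
    by simp
  then show ?thesis
    using card_subtrees_diff_le[OF assms, of t] by (simp add: distinct_fringe_subtrees_def)
qed

lemma occ_ge_1: "s \<in> subtrees t \<Longrightarrow> occ s t \<ge> 1"
proof (induction t)
  case (Node l x r)
  then show ?case using occ_nonneg[of s l] occ_nonneg[of s r] by auto
qed auto

text \<open>Equal fringe subtrees are never nested, so every repetition shows up as a disjoint pair.
  In the induction, the trees lost at the root are those occurring on both sides, and each yields
  such a pair.\<close>

lemma count_in_le_card:
  assumes "finite Q"
  shows "count_in Q t \<le> real (card (subtrees t \<inter> Q)) + (\<Sum>s\<in>Q. disjoint_pairs s s t)"
proof (induction t)
  case Leaf
  then show ?case using assms by (cases "Leaf \<in> Q") (auto simp: count_in_Leaf)
next
  case (Node l x r)
  let ?t = "Node l x r" and ?L = "subtrees l \<inter> Q" and ?R = "subtrees r \<inter> Q"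
  \<comment> \<open>The whole tree is larger than its proper fringe subtrees, so the root
    contributes a new one.\<close>
  have "?t \<notin> subtrees l" "?t \<notin> subtrees r"
    using size1_subtrees[of ?t l] size1_subtrees[of ?t r] size1_ge_1[of l] size1_ge_1[of r] by auto
  then have "real (card (subtrees ?t \<inter> Q)) = of_bool (?t \<in> Q) + real (card (?L \<union> ?R))"
    by (cases "?t \<in> Q") (auto simp: finite_subtrees Int_Un_distrib2 Int_insert_left card_insert_if)
  moreover have "real (card (?L \<union> ?R)) + real (card (?L \<inter> ?R)) = real (card ?L) + real (card ?R)"
    using card_Un_Int[of ?L ?R] by (simp only: finite_subtrees finite_Int simp_thms flip: of_nat_add)
  ultimately have card: "real (card (subtrees ?t \<inter> Q)) + real (card (?L \<inter> ?R))
      = of_bool (?t \<in> Q) + real (card ?L) + real (card ?R)"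
    by linarith
  have "real (card (?L \<inter> ?R)) = (\<Sum>s\<in>?L \<inter> ?R. 1)"
    by simp
  also have "\<dots> \<le> (\<Sum>s\<in>?L \<inter> ?R. occ s l * occ s r)"
  proof (rule sum_mono)
    fix s assume "s \<in> ?L \<inter> ?R"
    then have "1 * 1 \<le> occ s l * occ s r"
      by (intro mult_mono occ_ge_1) (auto simp: occ_nonneg)
    then show "1 \<le> occ s l * occ s r" by simp
  qed
  also have "\<dots> \<le> (\<Sum>s\<in>Q. occ s l * occ s r)"
    using assms by (intro sum_mono2) (auto simp: occ_nonneg)
  also have "\<dots> \<le> (\<Sum>s\<in>Q. occ s l * occ s r + occ s r * occ s l)"
    by (intro sum_mono) (simp add: occ_nonneg)
  finally show ?case
    using Node card assms by (simp add: count_in_Node sum.distrib)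
qed

text \<open>The square counts ordered pairs of nodes. Those not counted as disjoint are equal or
  nested; the upper node then has a fringe subtree with fewer than \<open>2 * M\<close> nodes, hence
  lies in fewer than \<open>4 * M\<close> such pairs.\<close>

lemma count_in_square_le:
  assumes "finite Q" and M: "\<And>s. s \<in> Q \<Longrightarrow> size1 s \<le> M"
  shows "(count_in Q t)\<^sup>2 \<le> (\<Sum>s\<in>Q. \<Sum>s'\<in>Q. disjoint_pairs s s' t) + 4 * real M * count_in Q t"
proof (induction t)
  case Leaf
  then show ?case
    using M[of Leaf] assms(1) by (cases "Leaf \<in> Q") (auto simp: count_in_Leaf)
next
  case (Node l x r)
  let ?t = "Node l x r" and ?l = "count_in Q l" and ?r = "count_in Q r"
  let ?b = "of_bool (?t \<in> Q) :: real"
  have c: "count_in Q ?t = ?b + ?l + ?r"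
    using assms(1) by (simp add: count_in_Node)
  \<comment> \<open>The pairs involving the root: with itself, and with each node below in both
    orders.\<close>
  have top: "?b * (?b + 2 * ?l + 2 * ?r) \<le> 4 * real M * ?b"
  proof (cases "?t \<in> Q")
    case True
    have "count_in Q ?t \<le> 2 * real (size1 ?t)"
      using card_subtrees_diff_le[OF assms(1), of ?t] by simp
    also have "\<dots> \<le> 2 * real M"
      using M[OF True] by (simp del: size1.simps)
    finally show ?thesis using True c by simp
  qed simp
  have prod: "(\<Sum>s\<in>Q. \<Sum>s'\<in>Q. occ s u * occ s' v) = count_in Q u * count_in Q v" for u v
    by (simp add: count_in_def sum_product)
  have "(\<Sum>s\<in>Q. \<Sum>s'\<in>Q. disjoint_pairs s s' ?t) =
      (\<Sum>s\<in>Q. \<Sum>s'\<in>Q. disjoint_pairs s s' l) + (\<Sum>s\<in>Q. \<Sum>s'\<in>Q. disjoint_pairs s s' r) + 2 * (?l * ?r)"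
    using prod[of l r] prod[of r l] by (simp add: sum.distrib mult.commute)
  moreover have "(count_in Q ?t)\<^sup>2 = ?b * (?b + 2 * ?l + 2 * ?r) + ?l\<^sup>2 + ?r\<^sup>2 + 2 * (?l * ?r)"
    unfolding c by (simp add: power2_eq_square algebra_simps)
  moreover have "4 * real M * count_in Q ?t = 4 * real M * ?b + 4 * real M * ?l + 4 * real M * ?r"
    unfolding c by (simp add: algebra_simps)
  ultimately show ?case using top Node by linarith
qed

section \<open>First and second moments for a range of sizes\<close>

definition trees_between :: "nat \<Rightarrow> nat \<Rightarrow> binary_tree set" where
  "trees_between i j = {t. i < size1 t \<and> size1 t \<le> j}"

lemma trees_between_same: "trees_between i i = {}"
  by (auto simp: trees_between_def)

lemma trees_between_Suc: "i \<le> j \<Longrightarrow> trees_between i (Suc j) = trees_between i j \<union> binary_trees (Suc j)"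
  by (auto simp: trees_between_def binary_trees_def)

lemma finite_trees_between: "finite (trees_between i j)"
proof (rule finite_subset)
  show "trees_between i j \<subseteq> (\<Union>k\<le>j. binary_trees k)"
    by (auto simp: trees_between_def binary_trees_def)
qed (simp add: finite_binary_trees)

lemma sum_trees_between_Suc:
  assumes "i \<le> j"
  shows "(\<Sum>t\<in>trees_between i (Suc j). (f t :: real))
    = (\<Sum>t\<in>trees_between i j. f t) + (\<Sum>t\<in>binary_trees (Suc j). f t)"
  unfolding trees_between_Suc[OF assms]
  by (rule sum.union_disjoint)
     (auto simp: finite_trees_between finite_binary_trees, auto simp: trees_between_def binary_trees_def)

lemma sum_weight_trees_between:
  assumes "i \<le> j"
  shows "(\<Sum>t\<in>trees_between i j. weight t) = 2 * (central i - central j)"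
  using assms
proof (induction j rule: dec_induct)
  case base
  then show ?case by (simp add: trees_between_same)
next
  case (step j)
  have "(\<Sum>t\<in>binary_trees (Suc j). weight t) = (\<Sum>t\<in>binary_trees (Suc j). 1 / 4 ^ j)"
    by (intro sum.cong) (auto simp: weight_def binary_trees_def)
  also have "\<dots> = num_trees (Suc j) / 4 ^ j"
    by simp
  finally show ?case
    using step by (simp add: sum_trees_between_Suc num_trees_telescope)
qed

lemma card_trees_between_le: "real (card (trees_between 0 j)) \<le> 4 ^ j"
proof (induction j)
  case 0
  then show ?case by (simp add: trees_between_same)
next
  case (Suc j)
  have "card (trees_between 0 (Suc j)) \<le> card (trees_between 0 j) + card (binary_trees (Suc j))"
    by (subst trees_between_Suc) (auto intro: card_Un_le)
  then have "real (card (trees_between 0 (Suc j))) \<le> real (card (trees_between 0 j)) + num_trees (Suc j)"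
    by simp
  also have "\<dots> \<le> 4 ^ j + 4 ^ j"
    by (intro add_mono Suc num_trees_le)
  finally show ?case by simp
qed

lemma mean_count_in_ge:
  assumes "i \<le> j" "j \<le> n"
  shows "2 * real n * (central i - central j) \<le> mean n (count_in (trees_between i j))"
proof -
  have "2 * real n * (central i - central j) = (\<Sum>s\<in>trees_between i j. real n * weight s)"
    using sum_weight_trees_between[OF assms(1)] by (simp flip: sum_distrib_left)
  also have "\<dots> \<le> (\<Sum>s\<in>trees_between i j. mean n (occ s))"
    using assms by (intro sum_mono mean_occ_ge) (auto simp: trees_between_def)
  also have "\<dots> = mean n (count_in (trees_between i j))"
    by (simp add: mean_sum[symmetric] count_in_def[abs_def])
  finally show ?thesis .
qed

text \<open>Centring at the lower bound \<open>a\<close> instead of the true mean makes the main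
  terms cancel: the second moment is at most \<open>a\<^sup>2 + 8 * M * n\<close>, and the cross
  term is at most \<open>- 2 * a\<^sup>2\<close>. Cauchy-Schwarz passes to the first absolute
  moment.\<close>

lemma mean_count_in_deviation:
  assumes "J \<le> M" "M \<le> n" "n \<ge> 1"
  defines "a \<equiv> 2 * real n * (central J - central M)"
  shows "mean n (\<lambda>t. \<bar>count_in (trees_between J M) t - a\<bar>) \<le> sqrt (8 * real M * real n)"
proof -
  let ?Q = "trees_between J M"
  let ?A = "count_in ?Q"
  have fin: "finite ?Q" by (rule finite_trees_between)
  have a0: "a \<ge> 0"
    unfolding a_def using central_antimono[OF assms(1)] by simp
  have EA: "a \<le> mean n ?A"
    unfolding a_def using assms by (intro mean_count_in_ge) auto
  have "mean n ?A \<le> mean n (\<lambda>_. 2 * real n)"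
  proof (rule mean_mono)
    fix t :: binary_tree assume "size1 t = n"
    then show "?A t \<le> 2 * real n"
      using card_subtrees_diff_le[OF fin, of t] by simp
  qed
  then have EA2: "mean n ?A \<le> 2 * real n"
    using assms by (simp add: mean_const)
  have "mean n (\<lambda>t. \<Sum>s\<in>?Q. \<Sum>s'\<in>?Q. disjoint_pairs s s' t)
      = (\<Sum>s\<in>?Q. \<Sum>s'\<in>?Q. mean n (disjoint_pairs s s'))"
    by (simp add: mean_sum)
  also have "\<dots> \<le> (\<Sum>s\<in>?Q. \<Sum>s'\<in>?Q. (real n)\<^sup>2 * weight s * weight s')"
    using assms by (intro sum_mono mean_disjoint_pairs_le)
  also have "\<dots> = (real n * (\<Sum>s\<in>?Q. weight s))\<^sup>2"
    by (simp add: power2_eq_square sum_product sum_distrib_left mult_ac)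
  also have "\<dots> = a\<^sup>2"
    by (simp add: sum_weight_trees_between[OF assms(1)] a_def mult_ac)
  finally have pairs: "mean n (\<lambda>t. \<Sum>s\<in>?Q. \<Sum>s'\<in>?Q. disjoint_pairs s s' t) \<le> a\<^sup>2" .
  have "mean n (\<lambda>t. (?A t)\<^sup>2)
      \<le> mean n (\<lambda>t. (\<Sum>s\<in>?Q. \<Sum>s'\<in>?Q. disjoint_pairs s s' t) + 4 * real M * ?A t)"
    by (intro mean_mono count_in_square_le fin) (auto simp: trees_between_def)
  also have "\<dots> \<le> a\<^sup>2 + 4 * real M * (2 * real n)"
    unfolding mean_add mean_cmult by (intro add_mono pairs mult_left_mono EA2) auto
  finally have sq: "mean n (\<lambda>t. (?A t)\<^sup>2) \<le> a\<^sup>2 + 8 * real M * real n"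
    by simp
  have "(mean n (\<lambda>t. \<bar>?A t - a\<bar>))\<^sup>2 \<le> mean n (\<lambda>t. \<bar>?A t - a\<bar>\<^sup>2)"
    by (rule mean_square_le)
  also have "(\<lambda>t. \<bar>?A t - a\<bar>\<^sup>2) = (\<lambda>t. (?A t)\<^sup>2 - 2 * a * ?A t + a\<^sup>2)"
    by (simp add: power2_diff fun_eq_iff)
  also have "mean n \<dots> = mean n (\<lambda>t. (?A t)\<^sup>2) - 2 * a * mean n ?A + a\<^sup>2"
    using assms by (simp add: mean_add mean_diff mean_cmult mean_const)
  also have "\<dots> \<le> 8 * real M * real n"
  proof -
    have "2 * a * a \<le> 2 * a * mean n ?A"
      using a0 EA by (intro mult_left_mono) auto
    then show ?thesis using sq by (simp add: power2_eq_square)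
  qed
  finally show ?thesis by (rule real_le_rsqrt)
qed

text \<open>One of the two weights in the pair bound is at most \<open>1 / 4 ^ J\<close>; the sum of
  the other telescopes to at most 2.\<close>

lemma mean_coincidences_le:
  assumes "J \<le> M" "n \<ge> 1"
  shows "mean n (\<lambda>t. \<Sum>s\<in>trees_between J M. disjoint_pairs s s t) \<le> 2 * (real n)\<^sup>2 / 4 ^ J"
proof -
  have "mean n (\<lambda>t. \<Sum>s\<in>trees_between J M. disjoint_pairs s s t)
      = (\<Sum>s\<in>trees_between J M. mean n (disjoint_pairs s s))"
    by (simp add: mean_sum)
  also have "\<dots> \<le> (\<Sum>s\<in>trees_between J M. (real n)\<^sup>2 / 4 ^ J * weight s)"
  proof (rule sum_mono)
    fix s assume "s \<in> trees_between J M"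
    then have "J \<le> size1 s - 1" by (auto simp: trees_between_def)
    then have "weight s \<le> 1 / 4 ^ J"
      unfolding weight_def by (intro divide_left_mono power_increasing) auto
    then have "(real n)\<^sup>2 * weight s * weight s \<le> (real n)\<^sup>2 * (1 / 4 ^ J) * weight s"
      by (intro mult_left_mono mult_right_mono weight_nonneg) auto
    then show "mean n (disjoint_pairs s s) \<le> (real n)\<^sup>2 / 4 ^ J * weight s"
      using mean_disjoint_pairs_le[OF assms(2), of s s] by simp
  qed
  also have "\<dots> = (real n)\<^sup>2 / 4 ^ J * (2 * (central J - central M))"
    by (simp only: sum_weight_trees_between[OF assms(1)] flip: sum_distrib_left)
  also have "\<dots> \<le> (real n)\<^sup>2 / 4 ^ J * (2 * 1)"
    using central_le_1[of J] central_pos[of M] by (intro mult_left_mono) auto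
  finally show ?thesis by (simp add: mult.commute)
qed

section \<open>Bounds on the number of distinct fringe subtrees\<close>

lemma mean_distinct_fringe_subtrees_le:
  assumes "I \<le> n" "n \<ge> 1"
  shows "mean n (\<lambda>t. real (distinct_fringe_subtrees t)) \<le> 4 ^ I + 2 * real n * central I"
proof -
  let ?Q = "trees_between 0 I"
  have "mean n (\<lambda>t. real (distinct_fringe_subtrees t))
      \<le> mean n (\<lambda>t. (real (card ?Q) + 2 * real n) - count_in ?Q t)"
  proof (rule mean_mono)
    fix t :: binary_tree assume "size1 t = n"
    then show "real (distinct_fringe_subtrees t) \<le> (real (card ?Q) + 2 * real n) - count_in ?Q t"
      using distinct_fringe_subtrees_le[OF finite_trees_between, of t 0 I] by simp
  qed
  also have "\<dots> = real (card ?Q) + 2 * real n - mean n (count_in ?Q)"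
    using assms by (simp add: mean_diff mean_const)
  \<comment> \<open>As \<open>central 0 = 1\<close>, the total \<open>2 * real n\<close> cancels,
    leaving only the nodes with large fringe subtrees.\<close>
  also have "\<dots> \<le> 4 ^ I + 2 * real n - 2 * real n * (central 0 - central I)"
    using assms by (intro diff_mono add_mono card_trees_between_le mean_count_in_ge) auto
  finally show ?thesis by (simp add: algebra_simps)
qed

text \<open>With H the number of distinct fringe subtrees, A the node count and P the pair count, H
  - A + P is nonnegative, so |H - A| is at most H - A + 2P. The absolute value is gone, and bounds
  on the means of H, A and P suffice.\<close>

lemma mean_deviation_le:
  assumes "I \<le> n" "J \<le> M" "M \<le> n" "n \<ge> 1"
  defines "a \<equiv> 2 * real n * (central J - central M)"
  shows "mean n (\<lambda>t. \<bar>real (distinct_fringe_subtrees t) - a\<bar>)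
    \<le> 4 ^ I + 2 * real n * central I - a + 4 * (real n)\<^sup>2 / 4 ^ J + sqrt (8 * real M * real n)"
proof -
  let ?Q = "trees_between J M"
  let ?H = "\<lambda>t. real (distinct_fringe_subtrees t)"
  let ?A = "count_in ?Q"
  let ?P = "\<lambda>t. \<Sum>s\<in>?Q. disjoint_pairs s s t"
  have "mean n (\<lambda>t. \<bar>?H t - a\<bar>) \<le> mean n (\<lambda>t. ?H t - ?A t + 2 * ?P t + \<bar>?A t - a\<bar>)"
  proof (rule mean_mono)
    fix t :: binary_tree
    have "card (subtrees t \<inter> ?Q) \<le> card (subtrees t)"
      by (intro card_mono finite_subtrees) auto
    then have "?A t \<le> ?H t + ?P t"
      using count_in_le_card[OF finite_trees_between, of J M t]
      by (simp add: distinct_fringe_subtrees_def)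
    moreover have "?P t \<ge> 0"
      by (intro sum_nonneg disjoint_pairs_nonneg)
    ultimately show "\<bar>?H t - a\<bar> \<le> ?H t - ?A t + 2 * ?P t + \<bar>?A t - a\<bar>"
      by linarith
  qed
  also have "\<dots> = mean n ?H - mean n ?A + 2 * mean n ?P + mean n (\<lambda>t. \<bar>?A t - a\<bar>)"
    by (simp add: mean_add mean_diff mean_cmult)
  also have "\<dots> \<le> (4 ^ I + 2 * real n * central I) - a + 2 * (2 * (real n)\<^sup>2 / 4 ^ J)
      + sqrt (8 * real M * real n)"
    unfolding a_def using assms
    by (intro add_mono diff_mono mult_left_mono mean_distinct_fringe_subtrees_le
        mean_count_in_ge mean_coincidences_le mean_count_in_deviation) auto
  finally show ?thesis by simp
qed

section \<open>Wallis' product and the asymptotics of \<open>central\<close>\<close>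

text \<open>From n - 1 to n the product gains the factor 4n^2 / (4n^2 - 1), and
  \<open>(central n)\<^sup>2 * (2 * real n + 1)\<close> gains its reciprocal.\<close>

lemma wallis_central:
  "(\<Prod>k=1..n. (4 * real k ^ 2) / (4 * real k ^ 2 - 1)) * ((central n)\<^sup>2 * (2 * real n + 1)) = 1"
proof (induction n)
  case (Suc n)
  let ?W = "\<lambda>n. \<Prod>k=1..n. (4 * real k ^ 2) / (4 * real k ^ 2 - 1)"
  define m where "m = real (Suc n)"
  have m: "m \<ge> 1" by (simp add: m_def)
  have "4 * m\<^sup>2 - 1 = (2 * m - 1) * (2 * m + 1)"
    by (simp add: power2_eq_square algebra_simps)
  moreover have "1 - 1 / (2 * m) = (2 * m - 1) / (2 * m)"
    using m by (simp add: field_simps)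
  moreover have "(4 * m\<^sup>2) / (u * v) * ((u / (2 * m))\<^sup>2 * v) = u" if "u > 0" "v > 0" for u v :: real
    using m that by (simp add: power2_eq_square)
  from this[of "2 * m - 1" "2 * m + 1"]
  have "(4 * m\<^sup>2) / ((2 * m - 1) * (2 * m + 1)) * (((2 * m - 1) / (2 * m))\<^sup>2 * (2 * m + 1)) = 2 * m - 1"
    using m by linarith
  ultimately have "(4 * m\<^sup>2) / (4 * m\<^sup>2 - 1) * ((1 - 1 / (2 * m))\<^sup>2 * (2 * m + 1)) = 2 * m - 1"
    by (simp only:)
  then have "?W n * (central n)\<^sup>2 * ((4 * m\<^sup>2) / (4 * m\<^sup>2 - 1) * ((1 - 1 / (2 * m))\<^sup>2 * (2 * m + 1)))
      = ?W n * (central n)\<^sup>2 * (2 * m - 1)"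
    by simp
  \<comment> \<open>Since m = n + 1, the leftover \<open>2 * m - 1\<close> is the
    \<open>2 * real n + 1\<close> of the induction hypothesis.\<close>
  also have "\<dots> = ?W n * ((central n)\<^sup>2 * (2 * real n + 1))"
    by (simp add: m_def)
  also note Suc.IH
  finally have F: "?W n * (central n)\<^sup>2 * ((4 * m\<^sup>2) / (4 * m\<^sup>2 - 1) * ((1 - 1 / (2 * m))\<^sup>2 * (2 * m + 1))) = 1" .
  have W: "?W (Suc n) = ?W n * ((4 * m\<^sup>2) / (4 * m\<^sup>2 - 1))"
    by (simp add: m_def)
  have c: "central (Suc n) = (1 - 1 / (2 * m)) * central n"
    by (simp add: central_Suc m_def)
  show ?case
    unfolding W c m_def[symmetric] power_mult_distrib
    by (rule trans[OF _ F]) (simp only: mult_ac)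
qed simp

lemma central_asymp: "(\<lambda>n. central n * sqrt (real n)) \<longlonglongrightarrow> 1 / sqrt pi"
proof -
  let ?W = "\<lambda>n. \<Prod>k=1..n. (4 * real k ^ 2) / (4 * real k ^ 2 - 1)"
  have eq: "real n / (2 * real n + 1) / ?W n = (central n)\<^sup>2 * real n" for n
  proof -
    have "x / y / w = c * x" if h: "w * (c * y) = 1" for x y w c :: real
    proof -
      have "w \<noteq> 0" "y \<noteq> 0" using h by auto
      then have "c * x = x * (w * (c * y)) / y / w" by simp
      then show ?thesis by (simp only: h mult_1_right)
    qed
    then show ?thesis using wallis_central[of n] .
  qed
  have "(\<lambda>n. real n / (2 * real n + 1)) \<longlonglongrightarrow> 1 / 2"
    by real_asymp
  then have "(\<lambda>n. real n / (2 * real n + 1) / ?W n) \<longlonglongrightarrow> 1 / 2 / (pi / 2)"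
    by (rule tendsto_divide[OF _ wallis]) simp
  then have "(\<lambda>n. sqrt ((central n)\<^sup>2 * real n)) \<longlonglongrightarrow> sqrt (1 / pi)"
    unfolding eq by (intro tendsto_real_sqrt) simp
  moreover have "sqrt ((central n)\<^sup>2 * real n) = central n * sqrt (real n)" for n
    using central_pos[of n] by (simp add: real_sqrt_mult)
  ultimately show ?thesis
    by (simp add: real_sqrt_divide)
qed

text \<open>For K(n) asymptotic to log 4 n, \<open>central (K n)\<close> behaves like 1 / sqrt (pi
  K(n)). The limit is half of \<open>fringe_const\<close>.\<close>

lemma central_subseq_asymp:
  assumes K: "(\<lambda>n. real (K n) / ln (real n)) \<longlonglongrightarrow> inverse (ln 4)"
  shows "(\<lambda>n. central (K n) * sqrt (ln (real n))) \<longlonglongrightarrow> sqrt (ln 4 / pi)"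
proof -
  have ln: "filterlim (\<lambda>n. ln (real n)) at_top sequentially"
    by real_asymp
  have pos: "\<forall>\<^sub>F n in sequentially. ln (real n) > 0"
    by real_asymp
  then have "\<forall>\<^sub>F n in sequentially. real (K n) / ln (real n) * ln (real n) = real (K n)"
    by eventually_elim simp
  moreover have "filterlim (\<lambda>n. real (K n) / ln (real n) * ln (real n)) at_top sequentially"
    by (rule filterlim_tendsto_pos_mult_at_top[OF K _ ln]) simp
  ultimately have "filterlim (\<lambda>n. real (K n)) at_top sequentially"
    by (simp only: filterlim_cong[OF refl refl])
  then have "filterlim K at_top sequentially"
    by (simp add: filterlim_sequentially_iff_filterlim_real)
  then have 1: "(\<lambda>n. central (K n) * sqrt (real (K n))) \<longlonglongrightarrow> 1 / sqrt pi"
    by (rule filterlim_compose[OF central_asymp])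
  have 2: "(\<lambda>n. inverse (sqrt (real (K n) / ln (real n)))) \<longlonglongrightarrow> inverse (sqrt (inverse (ln 4)))"
    using K by (intro tendsto_inverse tendsto_real_sqrt) auto
  have "1 / sqrt pi * inverse (sqrt (inverse (ln 4))) = sqrt (ln 4 / pi)"
    by (simp add: real_sqrt_divide real_sqrt_inverse)
  with tendsto_mult[OF 1 2]
  have "(\<lambda>n. central (K n) * sqrt (real (K n)) * inverse (sqrt (real (K n) / ln (real n))))
      \<longlonglongrightarrow> sqrt (ln 4 / pi)"
    by simp
  then show ?thesis
  proof (rule Lim_transform_eventually)
    \<comment> \<open>Cancelling \<open>sqrt (real (K n))\<close> requires it to be nonzero.\<close>
    have "\<forall>\<^sub>F n in sequentially. K n \<ge> 1"
      using \<open>filterlim K at_top sequentially\<close> by (simp add: filterlim_at_top)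
    then show "\<forall>\<^sub>F n in sequentially. central (K n) * sqrt (real (K n)) *
        inverse (sqrt (real (K n) / ln (real n))) = central (K n) * sqrt (ln (real n))"
      using pos by eventually_elim (simp add: real_sqrt_divide)
  qed
qed

section \<open>Cut-offs and the limit of the mean deviation\<close>

text \<open>
  The two cut-offs straddle \<open>log 4 n\<close>: the shift by \<open>log 4 (ln n)\<close> is large enough to make
  both the number of trees below the lower cut-off and the number of coincidences above
  the upper one negligible, and too small to change the leading term.
\<close>

definition lower_cutoff :: "nat \<Rightarrow> nat" where
  "lower_cutoff n = nat \<lfloor>log 4 (real n / ln (real n))\<rfloor>"

definition upper_cutoff :: "nat \<Rightarrow> nat" where
  "upper_cutoff n = nat \<lceil>log 4 (real n * ln (real n))\<rceil>"

text \<open>Large against ln n, so that fringe subtrees beyond it are negligible in number, yet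
  small enough that the deviation \<open>sqrt (8 * M * n)\<close>, of order n^(3/4), is negligible
  too.\<close>

definition max_size :: "nat \<Rightarrow> nat" where
  "max_size n = nat \<lfloor>sqrt (real n)\<rfloor>"

lemma power_lower_cutoff_le: "\<forall>\<^sub>F n in sequentially. 4 ^ lower_cutoff n \<le> real n / ln (real n)"
proof -
  \<comment> \<open>This makes the logarithm positive, so \<open>nat\<close> does not truncate a
    negative floor to 0.\<close>
  have "\<forall>\<^sub>F n in sequentially. real n / ln (real n) > 1" by real_asymp
  then show ?thesis
  proof eventually_elim
    case (elim n)
    let ?x = "log 4 (real n / ln (real n))"
    have "(4::real) ^ lower_cutoff n = 4 powr real (lower_cutoff n)"
      by (simp add: powr_realpow)
    also have "\<dots> \<le> 4 powr ?x"
      using elim unfolding lower_cutoff_def by (intro powr_mono) (auto simp: of_nat_floor)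
    also have "\<dots> = real n / ln (real n)"
      using elim by (intro powr_log_cancel) auto
    finally show ?case .
  qed
qed

lemma power_upper_cutoff_ge: "\<forall>\<^sub>F n in sequentially. real n * ln (real n) \<le> 4 ^ upper_cutoff n"
proof -
  have "\<forall>\<^sub>F n in sequentially. real n * ln (real n) > 0" by real_asymp
  then show ?thesis
  proof eventually_elim
    case (elim n)
    let ?x = "log 4 (real n * ln (real n))"
    have "real n * ln (real n) = 4 powr ?x"
      using elim by (intro powr_log_cancel[symmetric]) auto
    also have "\<dots> \<le> 4 powr real (upper_cutoff n)"
      unfolding upper_cutoff_def by (intro powr_mono real_nat_ceiling_ge) auto
    also have "\<dots> = 4 ^ upper_cutoff n"
      by (simp add: powr_realpow)
    finally show ?case .
  qed
qed

text \<open>Convergence in \<open>L\<^sup>1\<close>, which gives both claims at once.\<close>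

lemma mean_deviation_tendsto_0:
  "(\<lambda>n. mean n (\<lambda>t. \<bar>real (distinct_fringe_subtrees t) - fringe_const * (real n / sqrt (ln (real n)))\<bar>)
      * (sqrt (ln (real n)) / real n)) \<longlonglongrightarrow> 0"
proof -
  let ?c = "sqrt (ln 4 / pi)"
  let ?\<mu> = "\<lambda>n. fringe_const * (real n / sqrt (ln (real n)))"
  let ?H = "\<lambda>t. real (distinct_fringe_subtrees t)"
  define s where "s n = sqrt (ln (real n)) / real n" for n
  define a where "a n = 2 * real n * (central (upper_cutoff n) - central (max_size n))" for n
  \<comment> \<open>After scaling by \<open>s n\<close>, the terms of
    \<open>mean_deviation_le\<close> become: \<open>e\<close> and \<open>4 * e\<close> for the
    bounds on \<open>4 ^ I\<close> and on the coincidences, \<open>low\<close> for the nodes above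
    the lower cut-off, \<open>up\<close> for \<open>a\<close>, and \<open>f\<close> for the square
    root.\<close>
  define e where "e n = sqrt (ln (real n)) / ln (real n)" for n
  define f where "f n = sqrt (8 * real (max_size n) * real n) * s n" for n
  define low where "low n = 2 * (central (lower_cutoff n) * sqrt (ln (real n)))" for n
  define up where "up n = 2 * (central (upper_cutoff n) * sqrt (ln (real n))
      - central (max_size n) * sqrt (ln (real n)))" for n
  have low: "low \<longlonglongrightarrow> 2 * ?c"
    unfolding low_def
    by (intro tendsto_intros central_subseq_asymp) (unfold lower_cutoff_def, real_asymp)
  \<comment> \<open>\<open>central (max_size n)\<close> is of order n^(-1/4), which beats the
    logarithmic factor.\<close>
  have max: "(\<lambda>n. central (max_size n) * sqrt (ln (real n))) \<longlonglongrightarrow> 0"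
  proof -
    have "filterlim max_size at_top sequentially"
      unfolding max_size_def by real_asymp
    then have 1: "(\<lambda>n. central (max_size n) * sqrt (real (max_size n))) \<longlonglongrightarrow> 1 / sqrt pi"
      by (rule filterlim_compose[OF central_asymp])
    have 2: "(\<lambda>n. sqrt (ln (real n)) / sqrt (real (max_size n))) \<longlonglongrightarrow> 0"
      unfolding max_size_def by real_asymp
    have "\<forall>\<^sub>F n in sequentially. max_size n \<ge> 1"
      using \<open>filterlim max_size at_top sequentially\<close> by (simp add: filterlim_at_top)
    then have "\<forall>\<^sub>F n in sequentially. central (max_size n) * sqrt (real (max_size n)) *
        (sqrt (ln (real n)) / sqrt (real (max_size n))) = central (max_size n) * sqrt (ln (real n))"
      by eventually_elim simp
    with tendsto_mult[OF 1 2] show ?thesis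
      by (auto intro: Lim_transform_eventually)
  qed
  have up: "up \<longlonglongrightarrow> 2 * (?c - 0)"
    unfolding up_def
    by (intro tendsto_intros central_subseq_asymp max) (unfold upper_cutoff_def, real_asymp)
  have e: "e \<longlonglongrightarrow> 0"
    unfolding e_def by real_asymp
  have f: "f \<longlonglongrightarrow> 0"
    unfolding f_def s_def max_size_def by real_asymp
  \<comment> \<open>\<open>low\<close> and \<open>up\<close> share the limit \<open>2 * ?c\<close>,
    so upper and lower bounds meet.\<close>
  have "(\<lambda>n. e n + low n - up n + 4 * e n + f n + \<bar>up n - 2 * ?c\<bar>)
      \<longlonglongrightarrow> 0 + 2 * ?c - 2 * (?c - 0) + 4 * 0 + 0 + \<bar>2 * (?c - 0) - 2 * ?c\<bar>"
    by (intro tendsto_intros e f low up)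
  then have bound: "(\<lambda>n. e n + low n - up n + 4 * e n + f n + \<bar>up n - 2 * ?c\<bar>) \<longlonglongrightarrow> 0"
    by simp
  have "\<forall>\<^sub>F n in sequentially. lower_cutoff n \<le> n"
    unfolding lower_cutoff_def by real_asymp
  moreover have "\<forall>\<^sub>F n in sequentially. upper_cutoff n \<le> max_size n"
    unfolding upper_cutoff_def max_size_def by real_asymp
  moreover have "\<forall>\<^sub>F n in sequentially. max_size n \<le> n"
    unfolding max_size_def by real_asymp
  moreover have "\<forall>\<^sub>F n in sequentially. ln (real n) > 0"
    by real_asymp
  moreover note eventually_ge_at_top[of 1] power_lower_cutoff_le power_upper_cutoff_ge
  ultimately have ev: "\<forall>\<^sub>F n in sequentially. mean n (\<lambda>t. \<bar>?H t - ?\<mu> n\<bar>) * s n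
      \<le> e n + low n - up n + 4 * e n + f n + \<bar>up n - 2 * ?c\<bar>"
  proof eventually_elim
    case (elim n)
    have n: "real n > 0" using elim by simp
    have s: "s n > 0" using elim by (simp add: s_def)
    have as: "a n * s n = up n"
      using n by (simp add: a_def s_def up_def algebra_simps)
    have \<mu>s: "?\<mu> n * s n = 2 * ?c"
      using elim n by (simp add: s_def fringe_const_def)
    \<comment> \<open>Recentring from \<open>a n\<close> to the target costs a deterministic term,
      which scales to \<open>\<bar>up n - 2 * ?c\<bar>\<close>.\<close>
    have "mean n (\<lambda>t. \<bar>?H t - ?\<mu> n\<bar>) \<le> mean n (\<lambda>t. \<bar>?H t - a n\<bar> + \<bar>a n - ?\<mu> n\<bar>)"
      by (intro mean_mono) linarith
    also have "\<dots> = mean n (\<lambda>t. \<bar>?H t - a n\<bar>) + \<bar>a n - ?\<mu> n\<bar>"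
      using elim by (simp add: mean_add mean_const)
    also have "mean n (\<lambda>t. \<bar>?H t - a n\<bar>) \<le>
        4 ^ lower_cutoff n + 2 * real n * central (lower_cutoff n) - a n
        + 4 * (real n)\<^sup>2 / 4 ^ upper_cutoff n + sqrt (8 * real (max_size n) * real n)"
      unfolding a_def using elim by (intro mean_deviation_le) auto
    also have "4 ^ lower_cutoff n \<le> real n / ln (real n)"
      using elim by simp
    also have "4 * (real n)\<^sup>2 / 4 ^ upper_cutoff n \<le> 4 * (real n)\<^sup>2 / (real n * ln (real n))"
      using elim n by (intro divide_left_mono) auto
    finally have "mean n (\<lambda>t. \<bar>?H t - ?\<mu> n\<bar>) * s n \<le>
        (real n / ln (real n) + 2 * real n * central (lower_cutoff n) - a n
        + 4 * (real n)\<^sup>2 / (real n * ln (real n)) + sqrt (8 * real (max_size n) * real n)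
        + \<bar>a n - ?\<mu> n\<bar>) * s n"
      using s by (intro mult_right_mono) auto
    also have "\<dots> = real n / ln (real n) * s n + 2 * real n * central (lower_cutoff n) * s n - a n * s n
        + 4 * (real n)\<^sup>2 / (real n * ln (real n)) * s n + f n + \<bar>a n - ?\<mu> n\<bar> * s n"
      by (simp only: f_def distrib_right left_diff_distrib)
    also have "\<bar>a n - ?\<mu> n\<bar> * s n = \<bar>a n * s n - ?\<mu> n * s n\<bar>"
      using s by (simp only: left_diff_distrib[symmetric] abs_mult abs_of_pos)
    also have "real n / ln (real n) * s n = e n"
      using n by (simp add: s_def e_def)
    also have "4 * (real n)\<^sup>2 / (real n * ln (real n)) * s n = 4 * e n"
      using n by (simp add: s_def e_def power2_eq_square)
    also have "2 * real n * central (lower_cutoff n) * s n = low n"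
      using n by (simp add: s_def low_def)
    finally show ?case
      unfolding as \<mu>s .
  qed
  have nonneg: "0 \<le> mean n (\<lambda>t. \<bar>?H t - ?\<mu> n\<bar>) * s n" if "n \<ge> 1" for n
    unfolding mean_def s_def using that
    by (intro mult_nonneg_nonneg divide_nonneg_nonneg sum_nonneg) auto
  show ?thesis
    unfolding s_def[symmetric]
    by (rule tendsto_sandwich[OF _ ev tendsto_const bound])
       (use nonneg in \<open>auto intro: eventually_mono[OF eventually_ge_at_top[of 1]]\<close>)
qed

section \<open>Expectation and concentration from the mean deviation\<close>

theorem theorem3:
  shows "((\<lambda>n. measure_pmf.expectation (random_binary_tree n)
              (\<lambda>t. real (distinct_fringe_subtrees t)))
           \<sim>[at_top] (\<lambda>n. fringe_const * (real n / sqrt (ln (real n)))))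
    \<and> (\<forall>\<eta>::real. \<eta> > 0 \<longrightarrow>
           (\<lambda>n. measure_pmf.prob (random_binary_tree n)
              {t. \<bar>real (distinct_fringe_subtrees t) - fringe_const * (real n / sqrt (ln (real n)))\<bar>
                    \<le> \<eta> * (real n / sqrt (ln (real n)))}) \<longlonglongrightarrow> 1)"
proof (intro conjI allI impI)
  let ?\<mu> = "\<lambda>n. fringe_const * (real n / sqrt (ln (real n)))"
  let ?H = "\<lambda>t. real (distinct_fringe_subtrees t)"
  define s where "s n = sqrt (ln (real n)) / real n" for n
  define d where "d n = mean n (\<lambda>t. \<bar>?H t - ?\<mu> n\<bar>) * s n" for n
  have d: "d \<longlonglongrightarrow> 0"
    using mean_deviation_tendsto_0 unfolding d_def s_def .
  have c: "fringe_const > 0"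
    by (simp add: fringe_const_def)
  have large: "\<forall>\<^sub>F n in sequentially. n \<ge> 1 \<and> s n > 0"
  proof -
    have "\<forall>\<^sub>F n in sequentially. ln (real n) > 0" by real_asymp
    with eventually_ge_at_top[of 1] show ?thesis
      by eventually_elim (simp add: s_def)
  qed

  \<comment> \<open>The deviation of the mean is at most the mean deviation; divided by the target
    this is \<open>d n / fringe_const\<close>.\<close>
  show "(\<lambda>n. measure_pmf.expectation (random_binary_tree n) ?H) \<sim>[at_top] ?\<mu>"
  proof (rule asymp_equivI', rule LIM_zero_cancel, rule Lim_null_comparison)
    show "\<forall>\<^sub>F n in sequentially.
        norm (measure_pmf.expectation (random_binary_tree n) ?H / ?\<mu> n - 1) \<le> d n / fringe_const"
      using large
    proof eventually_elim
      case (elim n)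
      have rel: "\<bar>x - y\<bar> / y = \<bar>x / y - 1\<bar>" if "y > 0" for x y :: real
        using that by (simp add: abs_if field_simps)
      have \<mu>: "?\<mu> n = fringe_const / s n" by (simp add: s_def)
      have \<mu>_pos: "?\<mu> n > 0" unfolding \<mu> using elim c by simp
      have "mean n ?H - ?\<mu> n = mean n (\<lambda>t. ?H t - ?\<mu> n)"
        using elim by (simp add: mean_diff mean_const)
      then have "\<bar>mean n ?H - ?\<mu> n\<bar> \<le> mean n (\<lambda>t. \<bar>?H t - ?\<mu> n\<bar>)"
        by (simp add: mean_def divide_right_mono)
      then have "\<bar>mean n ?H - ?\<mu> n\<bar> / ?\<mu> n \<le> mean n (\<lambda>t. \<bar>?H t - ?\<mu> n\<bar>) / ?\<mu> n"
        using \<mu>_pos by (intro divide_right_mono) auto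
      also have "\<dots> = d n / fringe_const"
        unfolding d_def by (subst (2) \<mu>) simp
      also have "\<bar>mean n ?H - ?\<mu> n\<bar> / ?\<mu> n = \<bar>mean n ?H / ?\<mu> n - 1\<bar>"
        by (rule rel[OF \<mu>_pos])
      finally show ?case
        using elim by (simp add: expectation_random_binary_tree)
    qed
    show "(\<lambda>n. d n / fringe_const) \<longlonglongrightarrow> 0"
      using tendsto_divide_zero[OF d] .
  qed

  fix \<eta> :: real assume \<eta>: "\<eta> > 0"
  let ?G = "\<lambda>n. {t. \<bar>?H t - ?\<mu> n\<bar> \<le> \<eta> * (real n / sqrt (ln (real n)))}"
  show "(\<lambda>n. measure_pmf.prob (random_binary_tree n) (?G n)) \<longlonglongrightarrow> 1"
  proof (rule tendsto_sandwich)
    \<comment> \<open>Markov's inequality for the complement, obtained by averaging a pointwise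
      lower bound on the indicator of \<open>?G n\<close>.\<close>
    show "\<forall>\<^sub>F n in sequentially. 1 - d n / \<eta> \<le> measure_pmf.prob (random_binary_tree n) (?G n)"
      using large
    proof eventually_elim
      case (elim n)
      have s: "s n > 0" and n: "n \<ge> 1" using elim by auto
      have G: "t \<in> ?G n \<longleftrightarrow> \<bar>?H t - ?\<mu> n\<bar> * (s n / \<eta>) \<le> 1" for t
      proof -
        have "real n / sqrt (ln (real n)) = 1 / s n" by (simp add: s_def)
        moreover have "x \<le> \<eta> * (1 / s n) \<longleftrightarrow> x * (s n / \<eta>) \<le> 1" for x
          using s \<eta> by (simp add: field_simps)
        ultimately show ?thesis by (simp only: mem_Collect_eq)
      qed
      have "1 - d n / \<eta> = mean n (\<lambda>t. 1 - s n / \<eta> * \<bar>?H t - ?\<mu> n\<bar>)"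
        using n by (simp only: mean_diff mean_cmult mean_const d_def) simp
      also have "\<dots> \<le> mean n (indicator (?G n))"
      proof (rule mean_mono)
        fix t
        have "0 \<le> s n / \<eta> * \<bar>?H t - ?\<mu> n\<bar>" using s \<eta> by simp
        then show "1 - s n / \<eta> * \<bar>?H t - ?\<mu> n\<bar> \<le> indicator (?G n) t"
          using G[of t] by (cases "t \<in> ?G n") (auto simp: mult.commute)
      qed
      also have "\<dots> = measure_pmf.expectation (random_binary_tree n) (indicator (?G n))"
        using n by (rule expectation_random_binary_tree[symmetric])
      finally show ?case by simp
    qed
    have "(\<lambda>n. 1 - d n / \<eta>) \<longlonglongrightarrow> 1 - 0"
      by (intro tendsto_diff tendsto_const tendsto_divide_zero d)
    then show "(\<lambda>n. 1 - d n / \<eta>) \<longlonglongrightarrow> 1" by simp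
  qed auto
qed

end
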